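(* Let $g\in H(\mathbb{D})$ be univalent and let $0\le\alpha<1$. Then the Volterra operator $T_g\colon H^\infty_{v_\alpha}\to H^\infty$ is bounded if and only if $$\sup_{0\le\theta<2\pi}\int_0^1\frac{|g'(re^{i\theta})|}{(1-r^2)^\alpha}\,dr<\infty .$$
   Context: $\mathbb{D}$ is the open unit disc in $\mathbb{C}$ and $H(\mathbb{D})$ is the space of analytic functions on $\mathbb{D}$. For $g\in H(\mathbb{D})$ the classical Volterra operator is $T_g(f)(z)=\int_0^z f(\xi)g'(\xi)\,d\xi$, $z\in\mathbb{D}$, $f\in H(\mathbb{D})$. $H^\infty$ is the space of bounded analytic functions on $\mathbb{D}$ with the supremum norm. For $\alpha\ge 0$, $v_\alpha(z)=(1-|z|^2)^\alpha$ and $H^\infty_{v_\alpha}=\{f\in H(\mathbb{D}):\|f\|_{H^\infty_{v_\alpha}}=\sup_{z\in\mathbb{D}}(1-|z|^2)^\alpha|f(z)|<\infty\}$; for $\alpha=0$ this is $H^\infty$. Univalent means injective on $\mathbb{D}$. "$T_g\colon X\to Y$ is bounded" means that $T_g$ maps $X$ into $Y$ and is a bounded linear operator. *)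

theory Defs
  imports "HOL-Complex_Analysis.Complex_Analysis"
begin

abbreviation unit_disc :: "complex set" where
  "unit_disc \<equiv> ball 0 1"

text \<open>
  Analytic functions on the disc are represented by total functions on the complex plane; only
  their values on the disc matter. The sets below contain every total function whose restriction
  lies in the space, and the norms depend on that restriction only.
\<close>

definition Hinf :: "(complex \<Rightarrow> complex) set" where
  "Hinf = {f. f holomorphic_on unit_disc \<and> bounded (f ` unit_disc)}"

definition Hinf_norm :: "(complex \<Rightarrow> complex) \<Rightarrow> real" where
  "Hinf_norm f = (SUP z\<in>unit_disc. cmod (f z))"

definition v_weight :: "real \<Rightarrow> complex \<Rightarrow> real" where
  "v_weight \<alpha> z = (1 - (cmod z)\<^sup>2) powr \<alpha>"

definition Hv :: "real \<Rightarrow> (complex \<Rightarrow> complex) set" where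
  "Hv \<alpha> = {f. f holomorphic_on unit_disc \<and>
              bdd_above ((\<lambda>z. v_weight \<alpha> z * cmod (f z)) ` unit_disc)}"

definition Hv_norm :: "real \<Rightarrow> (complex \<Rightarrow> complex) \<Rightarrow> real" where
  "Hv_norm \<alpha> f = (SUP z\<in>unit_disc. v_weight \<alpha> z * cmod (f z))"

lemma v_weight_0: "z \<in> unit_disc \<Longrightarrow> v_weight 0 z = 1"
  by (auto simp: v_weight_def abs_square_eq_1)

lemma Hv_0: "Hv 0 = Hinf"
  by (auto simp: Hv_def Hinf_def v_weight_0 bdd_above_def bounded_iff simp del: mem_ball)

lemma Hv_norm_0: "Hv_norm 0 f = Hinf_norm f"
  by (simp add: Hv_norm_def Hinf_norm_def v_weight_0 cong: SUP_cong_simp del: mem_ball)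

definition volterra :: "(complex \<Rightarrow> complex) \<Rightarrow> (complex \<Rightarrow> complex) \<Rightarrow> complex \<Rightarrow> complex" where
  "volterra g f z = contour_integral (linepath 0 z) (\<lambda>\<xi>. f \<xi> * deriv g \<xi>)"

text \<open>
  Bounded linear operator from \<open>(X, nX)\<close> to \<open>(Y, nY)\<close>, two normed spaces of functions on the disc.
  Equality of functions means equality on the disc, so the library's type-based
  \<^const>\<open>bounded_linear\<close> does not apply.
\<close>

definition bounded_linear_operator ::
  "(complex \<Rightarrow> complex) set \<Rightarrow> ((complex \<Rightarrow> complex) \<Rightarrow> real) \<Rightarrow>
   (complex \<Rightarrow> complex) set \<Rightarrow> ((complex \<Rightarrow> complex) \<Rightarrow> real) \<Rightarrow>
   ((complex \<Rightarrow> complex) \<Rightarrow> complex \<Rightarrow> complex) \<Rightarrow> bool" where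
  "bounded_linear_operator X nX Y nY T \<longleftrightarrow>
     (\<forall>f\<in>X. T f \<in> Y) \<and>
     (\<forall>f\<in>X. \<forall>h\<in>X. \<forall>z\<in>unit_disc. T (\<lambda>w. f w + h w) z = T f z + T h z) \<and>
     (\<forall>c. \<forall>f\<in>X. \<forall>z\<in>unit_disc. T (\<lambda>w. c * f w) z = c * T f z) \<and>
     (\<exists>C. \<forall>f\<in>X. nY (T f) \<le> C * nX f)"

end

theory Submission
  imports Defs "HOL-Probability.Distributions"
begin

text \<open>
If the radial integrals are bounded, so is \<open>T_g\<close>: integrate along radii and bound \<open>f\<close> by its weighted
norm (\<open>volterra_norm_le\<close>).

Conversely, fix a direction \<open>e^{i \<theta>}\<close> and \<open>\<rho> < 1\<close>. It suffices to find a function \<open>f\<close> such that the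
norm of \<open>f\<close> in the weighted space is bounded independently of \<open>\<theta>\<close> and \<open>\<rho>\<close>, while on the radius up to \<open>\<rho>\<close> the
real part of \<open>f g' e^{i \<theta>}\<close> is at least half of \<open>|g'| / (1 - r^2)^\<alpha>\<close>. Then
\<open>|T_g f|\<close> at \<open>\<rho> e^{i \<theta>}\<close> is at least half of the radial integral up to \<open>\<rho>\<close>, and \<open>\<rho>\<close> may tend to \<open>1\<close>
(\<open>radial_integral_le_volterra\<close>).

On the radius \<open>f\<close> has to cancel the argument of \<open>g' e^{i \<theta>}\<close> approximately, yet be bounded up to the weight
in the whole disc. Univalence enters here: it makes \<open>log g'\<close> a Bloch function
(\<open>univalent_pre_schwarzian_bound\<close>), so the phase \<open>\<phi> = exp (- \<i> arg (g' e^{i \<theta>}))\<close> is Lipschitz on the radius in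
the hyperbolic coordinate \<open>s\<close> with \<open>r = tanh (s / 2)\<close>, with a constant that depends on nothing
(\<open>unimodular_radial_phase\<close>). The same coordinate maps the disc conformally onto a strip around the
real axis. Convolving \<open>\<phi>\<close> with a narrow Gaussian gives an entire function that is uniformly close to \<open>\<phi>\<close> on the
real segment, because \<open>\<phi>\<close> is Lipschitz, and bounded in the strip, because the Gaussian is integrable
along horizontal lines, uniformly in the strip (\<open>gauss_smooth_approx\<close>, \<open>norm_gauss_smooth_le\<close>).
Multiplying by \<open>(1 - z)^(-\<alpha>)\<close>, in the disc rotated so that the radius is real, accounts for the weight
(\<open>radial_test_function\<close>).
\<close>

section \<open>The pre-Schwarzian derivative of a univalent function\<close>

text \<open>
Otherwise the inverse function would map a disc of radius larger than \<open>2\<close> into the unit disc, and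
Cauchy's inequality would make its derivative at \<open>0\<close> at most \<open>1/2\<close>, whereas it equals \<open>1\<close>.
\<close>

lemma omitted_value_of_normalized_univalent:
  assumes holF: "F holomorphic_on ball 0 1" and inj: "inj_on F (ball 0 1)"
    and F0: "F 0 = 0" and dF0: "deriv F 0 = 1"
  obtains w where "w \<noteq> 0" "cmod w < 3" "w \<notin> F ` ball 0 1"
proof -
  have "\<not> ball 0 3 \<subseteq> F ` ball 0 1"
  proof
    assume sub: "ball 0 3 \<subseteq> F ` ball 0 1"
    obtain G where holG: "G holomorphic_on F ` ball 0 1"
      and dG: "\<And>z. z \<in> ball 0 1 \<Longrightarrow> deriv F z * deriv G (F z) = 1"
      and G: "\<And>z. z \<in> ball 0 1 \<Longrightarrow> G (F z) = z"
      using holomorphic_has_inverse[OF holF open_ball inj] by metis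
    have sub2: "cball 0 2 \<subseteq> F ` ball 0 1"
      using sub by (auto simp: subset_iff)
    have "norm ((deriv ^^ 1) G 0) \<le> fact 1 * 1 / 2 ^ 1"
    proof (rule Cauchy_inequality)
      show "G holomorphic_on ball 0 2"
        using holG sub2 ball_subset_cball holomorphic_on_subset by (metis subset_trans)
      show "continuous_on (cball 0 2) G"
        using holG sub2 holomorphic_on_imp_continuous_on continuous_on_subset by blast
      show "norm (G x) \<le> 1" if "cmod (0 - x) = 2" for x
      proof -
        have "x \<in> F ` ball 0 1" using sub2 that by (auto simp: subset_iff)
        then obtain z where "z \<in> ball 0 1" "x = F z" by blast
        then show ?thesis using G[of z] by simp
      qed
    qed simp
    moreover have "deriv G 0 = 1" using dG[of 0] F0 dF0 by simp
    ultimately show False by simp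
  qed
  then obtain w where w: "w \<in> ball 0 3" "w \<notin> F ` ball 0 1" by blast
  have "F 0 \<in> F ` ball 0 1" by (rule imageI) simp
  then have "w \<noteq> 0" using F0 w by auto
  then show ?thesis using that w by simp
qed

text \<open>
A value produced by Schottky's theorem, far from the sharp one. Only its
independence of the univalent function matters.
\<close>

definition pre_schwarzian_bound :: real where
  "pre_schwarzian_bound = 96 * (1 + (exp (pi * exp (pi * 16)))\<^sup>2)"

lemma pre_schwarzian_bound_nonneg: "pre_schwarzian_bound \<ge> 0"
  by (simp add: pre_schwarzian_bound_def)

text \<open>
Let \<open>w\<close> be an omitted value of \<open>F\<close>. The branch \<open>p\<close> of \<open>sqrt (1 - F / w)\<close> with \<open>p 0 = -1\<close>
omits \<open>0\<close>. It also omits \<open>1\<close>: there \<open>F\<close> would vanish, so by injectivity the point would be \<open>0\<close>,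
where \<open>p\<close> is \<open>-1\<close>. Schottky's theorem therefore bounds \<open>p\<close>, hence \<open>F = w (1 - p^2)\<close>, on a smaller
disc, and Cauchy's inequality bounds the second derivative.
\<close>

lemma normalized_univalent_second_deriv_bound:
  assumes holF: "F holomorphic_on ball 0 1" and inj: "inj_on F (ball 0 1)"
    and F0: "F 0 = 0" and dF0: "deriv F 0 = 1"
  shows "cmod (deriv (deriv F) 0) \<le> pre_schwarzian_bound"
proof -
  obtain w where w: "w \<noteq> 0" "cmod w < 3" "w \<notin> F ` ball 0 1"
    using omitted_value_of_normalized_univalent[OF assms] .
  obtain k where holk: "k holomorphic_on ball 0 1"
    and k: "\<And>z. z \<in> ball 0 1 \<Longrightarrow> 1 - F z / w = k z ^ 2"
  proof (rule contractible_imp_holomorphic_sqrt)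
    show "(\<lambda>z. 1 - F z / w) holomorphic_on ball 0 1"
      using w by (intro holomorphic_intros holF)
    show "1 - F z / w \<noteq> 0" if "z \<in> ball 0 1" for z
      using w that by (auto simp: field_simps)
  qed (auto intro: convex_imp_contractible)
  define p where "p = (\<lambda>z. - k z / k 0)"
  have k0: "k 0 ^ 2 = 1" using k[of 0] F0 by simp
  then have k0nz: "k 0 \<noteq> 0" by auto
  have p2: "p z ^ 2 = 1 - F z / w" if "z \<in> ball 0 1" for z
    using k[OF that] k0 by (simp add: p_def power_divide)
  have p0: "p 0 = -1" using k0nz by (simp add: p_def)
  have p01: "\<not> (p z = 0 \<or> p z = 1)" if z: "z \<in> ball 0 1" for z
  proof
    assume "p z = 0 \<or> p z = 1"
    then show False
    proof
      assume "p z = 0"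
      then show False using p2[OF z] w z by (auto simp: field_simps)
    next
      assume 1: "p z = 1"
      then have "F z = F 0" using p2[OF z] w F0 by simp
      then have "z = 0" using inj z by (auto dest: inj_onD)
      then show False using 1 p0 by simp
    qed
  qed
  define M where "M = exp (pi * exp (pi * 16))"
  have pM: "cmod (p z) \<le> M" if "cmod z \<le> 1/4" for z
  proof -
    \<comment> \<open>Schottky's theorem is stated on the closed unit disc, while \<open>p\<close> is holomorphic on the open one only.\<close>
    define q where "q = (\<lambda>z. p (z / 2))"
    have in_ball: "z / 2 \<in> ball 0 1" if "z \<in> cball 0 1" for z :: complex
      using that by (simp add: norm_divide)
    have "cmod (q (2 * z)) \<le> exp (pi * exp (pi * (2 + 2 * 1 + 12 * (1/2) / (1 - 1/2))))"
    proof (rule Schottky[of q 1 "1/2" "2 * z"])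
      have "p holomorphic_on ball 0 1"
        unfolding p_def using k0nz by (intro holomorphic_intros holk)
      then have "p \<circ> (\<lambda>z. z / 2) holomorphic_on cball 0 1"
        by (intro holomorphic_on_compose_gen[where t = "ball 0 1"] holomorphic_intros)
           (use in_ball in auto)
      then show "q holomorphic_on cball 0 1" by (simp add: q_def o_def)
      show "cmod (q 0) \<le> 1" by (simp add: q_def p0)
      show "\<not> (q z = 0 \<or> q z = 1)" if "z \<in> cball 0 1" for z
        unfolding q_def using p01[OF in_ball[OF that]] .
      show "cmod (2 * z) \<le> 1/2" using that by (simp add: norm_mult)
    qed auto
    then show ?thesis by (simp add: q_def M_def)
  qed
  have FM: "cmod (F z) \<le> 3 * (1 + M\<^sup>2)" if z: "cmod z \<le> 1/4" for z
  proof -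
    have "F z = w * (1 - p z ^ 2)" using p2[of z] z w by simp
    then have "cmod (F z) = cmod w * cmod (1 - p z ^ 2)" by (simp add: norm_mult)
    also have "\<dots> \<le> 3 * (1 + M\<^sup>2)"
    proof (rule mult_mono)
      have "cmod (1 - p z ^ 2) \<le> 1 + cmod (p z) ^ 2"
        by (metis norm_triangle_ineq4 norm_one norm_power)
      also have "\<dots> \<le> 1 + M\<^sup>2" using pM[OF z] by (simp add: power_mono)
      finally show "cmod (1 - p z ^ 2) \<le> 1 + M\<^sup>2" .
    qed (use w in auto)
    finally show ?thesis .
  qed
  have "norm ((deriv ^^ 2) F 0) \<le> fact 2 * (3 * (1 + M\<^sup>2)) / (1/4) ^ 2"
  proof (rule Cauchy_inequality)
    show "F holomorphic_on ball 0 (1/4)"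
      using holF by (rule holomorphic_on_subset) auto
    show "continuous_on (cball 0 (1/4)) F"
      using holomorphic_on_imp_continuous_on[OF holF] by (rule continuous_on_subset) auto
  qed (use FM in auto)
  then show ?thesis by (simp add: numeral_2_eq_2 pre_schwarzian_bound_def M_def)
qed

text \<open>
The bound at the origin, applied to the rescaling of \<open>g\<close> from the disc of radius \<open>1 - |a|\<close> around
\<open>a\<close>. It says that \<open>log g'\<close> is a Bloch function, with a norm that does not depend on \<open>g\<close>.
\<close>

lemma univalent_pre_schwarzian_bound:
  assumes holg: "g holomorphic_on ball 0 1" and inj: "inj_on g (ball 0 1)"
    and a: "a \<in> ball 0 1"
  shows "cmod (deriv (deriv g) a) * (1 - cmod a) \<le> pre_schwarzian_bound * cmod (deriv g a)"
proof -
  define d where "d = 1 - cmod a"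
  have d: "d > 0" using a by (simp add: d_def)
  define u where "u = (\<lambda>z::complex. a + of_real d * z)"
  have u: "u z \<in> ball 0 1" if "z \<in> ball 0 1" for z
  proof -
    have "cmod (u z) \<le> cmod a + d * cmod z"
      unfolding u_def using norm_triangle_ineq[of a "of_real d * z"] d by (simp add: norm_mult)
    also have "\<dots> < cmod a + d * 1" using that d by simp
    finally show ?thesis by (simp add: d_def)
  qed
  have dg: "deriv g a \<noteq> 0"
    using holomorphic_injective_imp_regular[OF holg open_ball inj a] .
  define c where "c = of_real d * deriv g a"
  have c: "c \<noteq> 0" using d dg by (simp add: c_def)
  define F where "F = (\<lambda>z. (g (u z) - g a) / c)"
  have du: "(u has_field_derivative of_real d) (at z)" for z
    unfolding u_def by (auto intro!: derivative_eq_intros)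
  have derF: "(F has_field_derivative (deriv g (u z) * of_real d / c)) (at z)"
    if z: "z \<in> ball 0 1" for z
    unfolding F_def using DERIV_chain2[OF holomorphic_derivI[OF holg open_ball u[OF z]] du]
    by (auto intro!: derivative_eq_intros simp: c)
  have derF': "deriv F z = deriv g (u z) * of_real d / c" if "z \<in> ball 0 1" for z
    using derF[OF that] by (rule DERIV_imp_deriv)
  have hol': "deriv g holomorphic_on ball 0 1" using holg by (intro holomorphic_deriv) auto
  have "((\<lambda>z. deriv g (u z) * of_real d / c) has_field_derivative
         (deriv (deriv g) (u 0) * of_real d * of_real d / c)) (at 0)"
    using DERIV_chain2[OF holomorphic_derivI[OF hol' open_ball u] du, of 0]
    by (auto intro!: derivative_eq_intros simp: c)
  then have "(deriv F has_field_derivative (deriv (deriv g) (u 0) * of_real d * of_real d / c)) (at 0)"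
    by (rule has_field_derivative_transform_within_open[where S = "ball 0 1"]) (auto simp: derF')
  then have ddF: "deriv (deriv F) 0 = deriv (deriv g) a * of_real d * of_real d / c"
    by (simp add: DERIV_imp_deriv u_def)
  have "cmod (deriv (deriv F) 0) \<le> pre_schwarzian_bound"
  proof (rule normalized_univalent_second_deriv_bound)
    show "F holomorphic_on ball 0 1"
      using derF by (metis holomorphic_on_open open_ball)
    show "inj_on F (ball 0 1)"
    proof (rule inj_onI)
      fix x y assume xy: "x \<in> ball 0 1" "y \<in> ball 0 1" "F x = F y"
      then have "g (u x) = g (u y)" using c by (simp add: F_def)
      then have "u x = u y" using inj u xy by (auto dest: inj_onD)
      then show "x = y" using d by (simp add: u_def)
    qed
    show "F 0 = 0" by (simp add: F_def u_def)
    show "deriv F 0 = 1" using derF'[of 0] d dg by (simp add: u_def c_def)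
  qed
  moreover have "cmod (deriv (deriv F) 0) = cmod (deriv (deriv g) a) * d / cmod (deriv g a)"
    using d dg by (simp add: ddF norm_mult norm_divide c_def)
  ultimately show ?thesis using dg by (simp add: d_def field_simps)
qed

section \<open>Gaussian smoothing of a function on the line\<close>

lemma continuous_on_if_abs_bound:
  fixes \<phi> :: "real \<Rightarrow> complex"
  assumes "\<And>s t. cmod (\<phi> s - \<phi> t) \<le> L * \<bar>s - t\<bar>" and "L \<ge> 0"
  shows "continuous_on S \<phi>"
proof -
  have "L-lipschitz_on S \<phi>"
    using assms by (intro lipschitz_onI) (auto simp: dist_norm)
  then show ?thesis by (rule lipschitz_on_continuous_on)
qed

text \<open>
The entire extension of the density of the centred normal distribution with standard deviation
\<open>\<sigma>\<close>.
\<close>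

definition gauss_kernel :: "real \<Rightarrow> complex \<Rightarrow> complex" where
  "gauss_kernel \<sigma> w = of_real (1 / sqrt (2 * pi * \<sigma>\<^sup>2)) * exp (- w\<^sup>2 / of_real (2 * \<sigma>\<^sup>2))"

text \<open>
The convolution is cut off at \<open>T\<close> so that holomorphy follows from differentiation under an
integral over a compact interval.
\<close>

definition gauss_smooth :: "real \<Rightarrow> real \<Rightarrow> (real \<Rightarrow> complex) \<Rightarrow> complex \<Rightarrow> complex" where
  "gauss_smooth \<sigma> T \<phi> w = integral {-T..T} (\<lambda>s. \<phi> s * gauss_kernel \<sigma> (w - of_real s))"

lemma gauss_kernel_of_real:
  "gauss_kernel \<sigma> (of_real x - of_real s) = of_real (normal_density x \<sigma> s)"
proof -
  have "- (complex_of_real x - of_real s)\<^sup>2 / of_real (2 * \<sigma>\<^sup>2) = of_real (- (s - x)\<^sup>2 / (2 * \<sigma>\<^sup>2))"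
    by (simp add: power2_commute)
  then show ?thesis
    by (simp only: gauss_kernel_def normal_density_def exp_of_real of_real_mult)
qed

lemma norm_gauss_kernel:
  "cmod (gauss_kernel \<sigma> (w - of_real s)) = exp ((Im w)\<^sup>2 / (2 * \<sigma>\<^sup>2)) * normal_density (Re w) \<sigma> s"
proof -
  have "Re (- (w - of_real s)\<^sup>2 / of_real (2 * \<sigma>\<^sup>2)) = (Im w)\<^sup>2 / (2 * \<sigma>\<^sup>2) + - (s - Re w)\<^sup>2 / (2 * \<sigma>\<^sup>2)"
    by (simp only: Re_divide_of_real) (simp add: power2_eq_square algebra_simps flip: add_divide_distrib diff_divide_distrib)
  then show ?thesis
    by (simp only: gauss_kernel_def normal_density_def norm_mult norm_exp_eq_Re exp_add norm_of_real)
       simp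
qed

lemma continuous_on_gauss_kernel [continuous_intros]:
  assumes "continuous_on S f"
  shows "continuous_on S (\<lambda>x. gauss_kernel \<sigma> (f x))"
  unfolding gauss_kernel_def divide_inverse by (intro continuous_intros assms)

lemma gauss_smooth_holomorphic:
  assumes "continuous_on {-T..T} \<phi>"
  shows "gauss_smooth \<sigma> T \<phi> holomorphic_on UNIV"
proof -
  have "(\<lambda>w. integral (cbox (-T) T) (\<lambda>s. \<phi> s * gauss_kernel \<sigma> (w - of_real s))) holomorphic_on UNIV"
  proof (rule leibniz_rule_holomorphic)
    show "((\<lambda>w. \<phi> s * gauss_kernel \<sigma> (w - of_real s)) has_field_derivative
            \<phi> s * (gauss_kernel \<sigma> (w - of_real s) * (- 2 * (w - of_real s) / of_real (2 * \<sigma>\<^sup>2))))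
          (at w within UNIV)" for w s
      unfolding gauss_kernel_def divide_inverse
      by (rule derivative_eq_intros refl | simp)+
    show "(\<lambda>s. \<phi> s * gauss_kernel \<sigma> (w - of_real s)) integrable_on cbox (-T) T" for w
      by (rule integrable_continuous) (use assms in \<open>auto intro!: continuous_intros\<close>)
    show "continuous_on (UNIV \<times> cbox (-T) T) (\<lambda>(w, s). \<phi> s *
            (gauss_kernel \<sigma> (w - of_real s) * (- 2 * (w - of_real s) / of_real (2 * \<sigma>\<^sup>2))))"
      unfolding case_prod_unfold divide_inverse
      by (intro continuous_intros continuous_on_compose2[OF assms]) auto
  qed auto
  then show ?thesis by (simp add: gauss_smooth_def[abs_def])
qed

lemma gauss_smooth_eq_lborel:
  assumes cont: "continuous_on {-T..T} \<phi>"
  shows "integrable lborel (\<lambda>s. indicator {-T..T} s *\<^sub>R (\<phi> s * gauss_kernel \<sigma> (w - of_real s)))"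
    and "gauss_smooth \<sigma> T \<phi> w =
      (LINT s|lborel. indicator {-T..T} s *\<^sub>R (\<phi> s * gauss_kernel \<sigma> (w - of_real s)))"
proof -
  have "set_integrable lborel {-T..T} (\<lambda>s. \<phi> s * gauss_kernel \<sigma> (w - of_real s))"
    by (rule borel_integrable_atLeastAtMost') (intro continuous_intros cont)
  from set_borel_integral_eq_integral(2)[OF this] this
  show "integrable lborel (\<lambda>s. indicator {-T..T} s *\<^sub>R (\<phi> s * gauss_kernel \<sigma> (w - of_real s)))"
    and "gauss_smooth \<sigma> T \<phi> w =
      (LINT s|lborel. indicator {-T..T} s *\<^sub>R (\<phi> s * gauss_kernel \<sigma> (w - of_real s)))"
    by (simp_all add: gauss_smooth_def set_lebesgue_integral_def set_integrable_def)
qed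

text \<open>
On a horizontal line the kernel is a normal density up to the factor
\<open>exp (y^2 / (2 \<sigma>^2))\<close>. Hence the bound is uniform in a horizontal strip and independent of \<open>T\<close>.
\<close>

lemma norm_gauss_smooth_le:
  assumes cont: "continuous_on {-T..T} \<phi>" and le: "\<And>s. cmod (\<phi> s) \<le> 1" and \<sigma>: "\<sigma> > 0"
  shows "cmod (gauss_smooth \<sigma> T \<phi> w) \<le> exp ((Im w)\<^sup>2 / (2 * \<sigma>\<^sup>2))"
proof -
  let ?E = "exp ((Im w)\<^sup>2 / (2 * \<sigma>\<^sup>2))"
  have "cmod (gauss_smooth \<sigma> T \<phi> w) \<le> (LINT s|lborel. ?E * normal_density (Re w) \<sigma> s)"
    unfolding gauss_smooth_eq_lborel(2)[OF cont]
  proof (rule order_trans[OF integral_norm_bound integral_mono])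
    show "integrable lborel (\<lambda>s. cmod (indicator {-T..T} s *\<^sub>R (\<phi> s * gauss_kernel \<sigma> (w - of_real s))))"
      by (rule integrable_norm[OF gauss_smooth_eq_lborel(1)[OF cont]])
    show "integrable lborel (\<lambda>s. ?E * normal_density (Re w) \<sigma> s)"
      using \<sigma> by simp
    show "cmod (indicator {-T..T} s *\<^sub>R (\<phi> s * gauss_kernel \<sigma> (w - of_real s)))
          \<le> ?E * normal_density (Re w) \<sigma> s" for s
      using mult_right_mono[OF le[of s], of "?E * normal_density (Re w) \<sigma> s"]
      by (auto simp: indicator_def norm_mult norm_gauss_kernel)
  qed
  then show ?thesis using \<sigma> by simp
qed

text \<open>
The error is the mean of \<open>|\<psi> s - \<phi> x|\<close> against the normal density centred at \<open>x\<close>, where \<open>\<psi>\<close> is \<open>\<phi>\<close>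
cut off at \<open>T\<close>. Increasing the Lipschitz constant by one pays for the cut-off: where \<open>\<psi>\<close>
differs from \<open>\<phi>\<close> the distance to \<open>x\<close> is at least \<open>1\<close>, and \<open>|\<phi> x|\<close> is at most \<open>1\<close>. What remains is
the first absolute moment of the normal distribution.
\<close>

lemma gauss_smooth_approx:
  assumes le: "\<And>s. cmod (\<phi> s) \<le> 1"
    and lip: "\<And>s t. cmod (\<phi> s - \<phi> t) \<le> L * \<bar>s - t\<bar>"
    and L: "L \<ge> 0" and \<sigma>: "\<sigma> > 0" and x: "\<bar>x\<bar> \<le> T - 1"
  shows "cmod (gauss_smooth \<sigma> T \<phi> (of_real x) - \<phi> x) \<le> (L + 1) * \<sigma> * sqrt (2 / pi)"
proof -
  have cont: "continuous_on {-T..T} \<phi>"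
    using lip L by (rule continuous_on_if_abs_bound)
  let ?n = "normal_density x \<sigma>"
  let ?\<psi> = "\<lambda>s. indicator {-T..T} s *\<^sub>R \<phi> s"
  let ?I = "\<lambda>s. indicator {-T..T} s *\<^sub>R (\<phi> s * gauss_kernel \<sigma> (of_real x - of_real s))"
  have int1: "integrable lborel ?I" by (rule gauss_smooth_eq_lborel(1)[OF cont])
  have int2: "integrable lborel (\<lambda>s. ?n s *\<^sub>R \<phi> x)"
    using \<sigma> by simp
  have "(LINT s|lborel. ?n s *\<^sub>R \<phi> x) = \<phi> x"
    using \<sigma> by simp
  then have diff: "gauss_smooth \<sigma> T \<phi> (of_real x) - \<phi> x = (LINT s|lborel. ?I s - ?n s *\<^sub>R \<phi> x)"
    using int1 int2 by (simp only: gauss_smooth_eq_lborel(2)[OF cont] Bochner_Integration.integral_diff)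
  have "cmod (gauss_smooth \<sigma> T \<phi> (of_real x) - \<phi> x) \<le> (LINT s|lborel. (L + 1) * (?n s * \<bar>s - x\<bar> ^ (2 * 0 + 1)))"
    unfolding diff
  proof (rule order_trans[OF integral_norm_bound integral_mono])
    show "integrable lborel (\<lambda>s. cmod (?I s - ?n s *\<^sub>R \<phi> x))"
      using int1 int2 by (intro integrable_norm Bochner_Integration.integrable_diff)
    show "integrable lborel (\<lambda>s. (L + 1) * (?n s * \<bar>s - x\<bar> ^ (2 * 0 + 1)))"
      by (intro integrable_mult_right integrable_normal_moment_abs \<sigma>)
    fix s
    have "?I s - ?n s *\<^sub>R \<phi> x = ?n s *\<^sub>R (?\<psi> s - \<phi> x)"
      by (simp add: gauss_kernel_of_real scaleR_conv_of_real algebra_simps)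
    then have "cmod (?I s - ?n s *\<^sub>R \<phi> x) = ?n s * cmod (?\<psi> s - \<phi> x)"
      by (simp add: abs_of_nonneg)
    also have "\<dots> \<le> ?n s * ((L + 1) * \<bar>s - x\<bar>)"
    proof (rule mult_left_mono)
      show "cmod (?\<psi> s - \<phi> x) \<le> (L + 1) * \<bar>s - x\<bar>"
      proof (cases "s \<in> {-T..T}")
        case True
        then show ?thesis using lip[of s x] by (simp add: algebra_simps)
      next
        case False
        then have "1 \<le> \<bar>s - x\<bar>" using x by auto
        then have "1 \<le> (L + 1) * \<bar>s - x\<bar>"
          using L by (metis add.commute le_add_same_cancel1 mult_mono' mult_1 zero_le_one)
        then show ?thesis using False le[of x] by simp
      qed
    qed simp
    finally show "cmod (?I s - ?n s *\<^sub>R \<phi> x) \<le> (L + 1) * (?n s * \<bar>s - x\<bar> ^ (2 * 0 + 1))"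
      by (simp add: mult.left_commute)
  qed
  then show ?thesis
    using integral_normal_moment_abs_odd[OF \<sigma>, of x 0] by (simp add: mult.assoc)
qed

section \<open>A test function for a given radius\<close>

text \<open>
The phase is \<open>\<phi> = exp (- \<i> arg h')\<close> along the radius, in the coordinate \<open>r = tanh (s / 2)\<close>, for which
\<open>s\<close> is the hyperbolic distance from \<open>0\<close>. In this coordinate
\<open>dr/ds = (1 - r^2) / 2 \<le> 1 - |r|\<close>, so the bound on \<open>h'' / h'\<close> becomes a Lipschitz bound for \<open>\<phi>\<close>.
\<close>

lemma unimodular_radial_phase:
  assumes holh: "h holomorphic_on ball 0 1" and inj: "inj_on h (ball 0 1)"
  obtains \<phi> :: "real \<Rightarrow> complex"
  where "\<And>s. cmod (\<phi> s) = 1"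
    and "\<And>s t. cmod (\<phi> s - \<phi> t) \<le> pre_schwarzian_bound * \<bar>s - t\<bar>"
    and "\<And>s. \<phi> s * deriv h (of_real (tanh (s / 2))) = of_real (cmod (deriv h (of_real (tanh (s / 2)))))"
proof -
  have hol': "deriv h holomorphic_on ball 0 1" using holh by (intro holomorphic_deriv) auto
  have nz: "deriv h z \<noteq> 0" if "z \<in> ball 0 1" for z
    using holomorphic_injective_imp_regular[OF holh open_ball inj that] .
  obtain l where holl: "l holomorphic_on ball 0 1"
    and l: "\<And>z. z \<in> ball 0 1 \<Longrightarrow> deriv h z = exp (l z)"
    using contractible_imp_holomorphic_log[OF hol' convex_imp_contractible[OF convex_ball] nz] by blast
  have dl: "cmod (deriv l z) * (1 - cmod z) \<le> pre_schwarzian_bound" if z: "z \<in> ball 0 1" for z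
  proof -
    have "((\<lambda>z. exp (l z)) has_field_derivative exp (l z) * deriv l z) (at z)"
      by (rule DERIV_chain2[OF DERIV_exp holomorphic_derivI[OF holl open_ball z]])
    then have "(deriv h has_field_derivative exp (l z) * deriv l z) (at z)"
      by (rule has_field_derivative_transform_within_open[where S = "ball 0 1"]) (use z l in auto)
    then have "deriv (deriv h) z = deriv h z * deriv l z"
      using l[OF z] by (simp add: DERIV_imp_deriv)
    then have "cmod (deriv h z) * (cmod (deriv l z) * (1 - cmod z)) \<le> cmod (deriv h z) * pre_schwarzian_bound"
      using univalent_pre_schwarzian_bound[OF holh inj z] by (simp add: norm_mult mult_ac)
    then show ?thesis using nz[OF z] by simp
  qed
  define \<gamma> where "\<gamma> = (\<lambda>s::real. tanh (s / 2))"
  have \<gamma>1: "\<bar>\<gamma> s\<bar> < 1" for s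
    using tanh_real_bounds[of "s / 2"] by (auto simp: \<gamma>_def)
  then have \<gamma>ball: "of_real (\<gamma> s) \<in> ball (0::complex) 1" for s by simp
  define \<psi> where "\<psi> = (\<lambda>s. l (of_real (\<gamma> s)))"
  define \<psi>' where "\<psi>' = (\<lambda>s. deriv l (of_real (\<gamma> s)) * of_real ((1 - (\<gamma> s)\<^sup>2) / 2))"
  have d\<psi>: "(\<psi> has_vector_derivative \<psi>' s) (at s)" for s
  proof -
    have "(\<gamma> has_real_derivative (1 - (\<gamma> s)\<^sup>2) / 2) (at s)"
      unfolding \<gamma>_def by (auto intro!: derivative_eq_intros simp: cosh_real_nonzero)
    then have "((\<lambda>s. complex_of_real (\<gamma> s)) has_vector_derivative of_real ((1 - (\<gamma> s)\<^sup>2) / 2)) (at s)"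
      by (intro has_vector_derivative_of_real) (simp add: has_real_derivative_iff_has_vector_derivative)
    from field_vector_diff_chain_at[OF this holomorphic_derivI[OF holl open_ball \<gamma>ball]]
    show ?thesis by (simp add: \<psi>_def \<psi>'_def o_def mult.commute)
  qed
  have \<psi>'_le: "cmod (\<psi>' s) \<le> pre_schwarzian_bound" for s
  proof -
    have "(1 - (\<gamma> s)\<^sup>2) / 2 = (1 - \<bar>\<gamma> s\<bar>) * ((1 + \<bar>\<gamma> s\<bar>) / 2)"
      by (simp add: algebra_simps power2_eq_square)
    also have "\<dots> \<le> (1 - \<bar>\<gamma> s\<bar>) * 1"
      using \<gamma>1[of s] by (intro mult_left_mono) auto
    finally have le: "(1 - (\<gamma> s)\<^sup>2) / 2 \<le> 1 - \<bar>\<gamma> s\<bar>" by simp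
    have "0 \<le> (1 - (\<gamma> s)\<^sup>2) / 2" using \<gamma>1[of s] by (simp add: abs_square_le_1)
    then have "cmod (\<psi>' s) = cmod (deriv l (of_real (\<gamma> s))) * ((1 - (\<gamma> s)\<^sup>2) / 2)"
      unfolding \<psi>'_def norm_mult norm_of_real by simp
    also have "\<dots> \<le> cmod (deriv l (of_real (\<gamma> s))) * (1 - \<bar>\<gamma> s\<bar>)"
      using le by (intro mult_left_mono) auto
    also have "\<dots> \<le> pre_schwarzian_bound" using dl[OF \<gamma>ball[of s]] by simp
    finally show ?thesis .
  qed
  define \<phi> where "\<phi> = (\<lambda>s. exp (- \<i> * of_real (Im (\<psi> s))))"
  have norm\<phi>: "cmod (\<phi> s) = 1" for s by (simp add: \<phi>_def)
  have d\<phi>: "(\<phi> has_vector_derivative (- \<i> * of_real (Im (\<psi>' s))) * \<phi> s) (at s)" for s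
  proof -
    have "((\<lambda>s. Im (\<psi> s)) has_vector_derivative Im (\<psi>' s)) (at s)"
      by (rule bounded_linear.has_vector_derivative[OF bounded_linear_Im d\<psi>])
    then have "((\<lambda>s. - \<i> * of_real (Im (\<psi> s))) has_vector_derivative - \<i> * of_real (Im (\<psi>' s))) (at s)"
      by (intro has_vector_derivative_mult_right has_vector_derivative_of_real)
         (simp add: has_real_derivative_iff_has_vector_derivative)
    from field_vector_diff_chain_at[OF this DERIV_exp]
    show ?thesis by (simp add: \<phi>_def o_def)
  qed
  have "cmod (\<phi> s - \<phi> t) \<le> pre_schwarzian_bound * norm (s - t)" for s t
  proof (rule differentiable_bound[of UNIV])
    show "(\<phi> has_derivative (\<lambda>x. x *\<^sub>R (- \<i> * of_real (Im (\<psi>' s)) * \<phi> s))) (at s within UNIV)" for s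
      using d\<phi>[of s] by (simp add: has_vector_derivative_def)
    show "onorm (\<lambda>x. x *\<^sub>R (- \<i> * of_real (Im (\<psi>' s)) * \<phi> s)) \<le> pre_schwarzian_bound" for s
    proof (rule onorm_le)
      show "cmod (x *\<^sub>R (- \<i> * of_real (Im (\<psi>' s)) * \<phi> s)) \<le> pre_schwarzian_bound * norm x" for x
        using mult_left_mono[OF order_trans[OF abs_Im_le_cmod \<psi>'_le[of s]], of "\<bar>x\<bar>"]
        by (simp add: norm_mult norm\<phi> mult.commute)
    qed
  qed auto
  moreover have "\<phi> s * deriv h (of_real (\<gamma> s)) = of_real (cmod (deriv h (of_real (\<gamma> s))))" for s
  proof -
    have "\<phi> s * deriv h (of_real (\<gamma> s)) = exp (- \<i> * of_real (Im (\<psi> s)) + \<psi> s)"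
      by (simp only: l[OF \<gamma>ball] \<phi>_def \<psi>_def exp_add)
    also have "- \<i> * of_real (Im (\<psi> s)) + \<psi> s = of_real (Re (\<psi> s))"
      by (simp add: complex_eq_iff)
    also have "exp \<dots> = of_real (cmod (deriv h (of_real (\<gamma> s))))"
      by (simp add: l[OF \<gamma>ball] \<psi>_def exp_of_real)
    finally show ?thesis .
  qed
  ultimately show ?thesis using that[of \<phi>] norm\<phi> by (simp add: \<gamma>_def)
qed

lemma tanh_half_ln:
  assumes "0 \<le> r" "r < (1::real)"
  shows "tanh (ln ((1 + r) / (1 - r)) / 2) = r"
proof -
  have "ln ((1 + r) / (1 - r)) / 2 = ln (sqrt ((1 + r) / (1 - r)))"
    using assms by (simp add: ln_sqrt)
  also have "tanh \<dots> = ((1 + r) / (1 - r) - 1) / ((1 + r) / (1 - r) + 1)"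
    using assms by (simp add: tanh_ln_real)
  also have "\<dots> = r" using assms by (simp add: field_simps)
  finally show ?thesis .
qed

text \<open>
Chosen so that the error bound of \<open>gauss_smooth_approx\<close> is at most \<open>1/2\<close> for a function with
Lipschitz constant \<open>pre_schwarzian_bound\<close>.
\<close>

definition smooth_width :: real where
  "smooth_width = 1 / (2 * (pre_schwarzian_bound + 1))"

text \<open>
The first factor comes from the weight, the second is the growth of the Gaussian kernel in the strip
of half-width \<open>pi / 2\<close>.
\<close>

definition test_bound :: "real \<Rightarrow> real" where
  "test_bound \<alpha> = 2 powr \<alpha> * exp ((pi / 2)\<^sup>2 / (2 * smooth_width\<^sup>2))"

text \<open>
The function \<open>W z = Ln ((1 + z) / (1 - z))\<close> maps the disc onto the strip \<open>|Im w| < pi / 2\<close> and the radius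
onto the half-line, in the coordinate used for the phase. There \<open>F\<close>, the Gaussian smoothing of the
phase \<open>\<phi>\<close> of \<open>h'\<close>, is bounded in the strip and \<open>1/2\<close>-close to \<open>\<phi>\<close> on the real segment that corresponds
to \<open>[0, \<rho>]\<close>. Since \<open>\<phi> h' = |h'|\<close>, the real part of \<open>F h'\<close> is at least \<open>|h'| / 2\<close>. The factor
\<open>P z = (1 - z)^(-\<alpha>)\<close> supplies the largest growth that the weight admits, because
\<open>1 - |z|^2 \<le> 2 |1 - z|\<close>. The bound on the test function involves neither \<open>h\<close> nor \<open>\<rho>\<close>; only the cut-off \<open>T\<close>
depends on \<open>\<rho>\<close>.
\<close>

lemma radial_test_function:
  assumes holh: "h holomorphic_on ball 0 1" and inj: "inj_on h (ball 0 1)"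
    and \<alpha>: "\<alpha> \<ge> 0" and \<rho>: "0 \<le> \<rho>" "\<rho> < 1"
  obtains f where "f holomorphic_on ball 0 1"
    and "\<And>z. z \<in> ball 0 1 \<Longrightarrow> (1 - (cmod z)\<^sup>2) powr \<alpha> * cmod (f z) \<le> test_bound \<alpha>"
    and "\<And>r. r \<in> {0..\<rho>} \<Longrightarrow>
      1/2 * (cmod (deriv h (of_real r)) / (1 - r\<^sup>2) powr \<alpha>) \<le> Re (f (of_real r) * deriv h (of_real r))"
proof -
  obtain \<phi> where norm\<phi>: "\<And>s. cmod (\<phi> s) = 1"
    and lip: "\<And>s t. cmod (\<phi> s - \<phi> t) \<le> pre_schwarzian_bound * \<bar>s - t\<bar>"
    and phase: "\<And>s. \<phi> s * deriv h (of_real (tanh (s / 2))) = of_real (cmod (deriv h (of_real (tanh (s / 2)))))"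
    using unimodular_radial_phase[OF holh inj] by metis
  have \<sigma>: "smooth_width > 0" using pre_schwarzian_bound_nonneg by (simp add: smooth_width_def)
  \<comment> \<open>The summand \<open>1\<close> keeps the segment at distance \<open>1\<close> from the cut-off.\<close>
  define T where "T = ln ((1 + \<rho>) / (1 - \<rho>)) + 1"
  define F where "F = gauss_smooth smooth_width T \<phi>"
  define W where "W = (\<lambda>z::complex. Ln ((1 + z) / (1 - z)))"
  define P where "P = (\<lambda>z::complex. exp (- of_real \<alpha> * Ln (1 - z)))"
  define f where "f = (\<lambda>z. P z * F (W z))"
  have cont\<phi>: "continuous_on {-T..T} \<phi>"
    using lip pre_schwarzian_bound_nonneg by (rule continuous_on_if_abs_bound)
  have Re_pos: "Re ((1 + z) / (1 - z)) > 0" if "z \<in> ball 0 1" for z :: complex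
  proof -
    have "(Re z)\<^sup>2 + (Im z)\<^sup>2 < 1"
      using that by (simp add: cmod_def)
    then show ?thesis
      by (simp add: Re_complex_div_gt_0 algebra_simps power2_eq_square)
  qed
  have Re_pos': "Re (1 - z) > 0" if "z \<in> ball 0 1" for z :: complex
    using that complex_Re_le_cmod[of z] by simp
  have ImW: "\<bar>Im (W z)\<bar> \<le> pi / 2" if "z \<in> ball 0 1" for z
  proof -
    have "(1 + z) / (1 - z) \<noteq> 0" using Re_pos[OF that] by (metis less_irrefl zero_complex.simps(1))
    then show ?thesis using Re_Ln_pos_lt[of "(1 + z) / (1 - z)"] Re_pos[OF that] by (simp add: W_def)
  qed
  have "f holomorphic_on ball 0 1"
  proof -
    have "W holomorphic_on ball 0 1"
      unfolding W_def
    proof (intro holomorphic_intros)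
      show "(1 + z) / (1 - z) \<notin> \<real>\<^sub>\<le>\<^sub>0" if "z \<in> ball 0 1" for z :: complex
        using Re_pos[OF that] by (auto simp: complex_nonpos_Reals_iff)
    qed auto
    moreover have "F holomorphic_on UNIV"
      unfolding F_def by (rule gauss_smooth_holomorphic[OF cont\<phi>])
    ultimately have "F \<circ> W holomorphic_on ball 0 1"
      by (rule holomorphic_on_compose_gen) simp
    moreover have "P holomorphic_on ball 0 1"
      unfolding P_def
    proof (intro holomorphic_intros)
      show "1 - z \<notin> \<real>\<^sub>\<le>\<^sub>0" if "z \<in> ball 0 1" for z :: complex
        using Re_pos'[OF that] by (auto simp: complex_nonpos_Reals_iff)
    qed
    ultimately show ?thesis by (auto simp: f_def o_def intro: holomorphic_on_mult)
  qed
  moreover have "(1 - (cmod z)\<^sup>2) powr \<alpha> * cmod (f z) \<le> test_bound \<alpha>" if z: "z \<in> ball 0 1" for z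
  proof -
    have z1: "cmod z < 1" using z by simp
    have nz: "1 - z \<noteq> 0" using z by auto
    have P: "cmod (P z) = cmod (1 - z) powr (-\<alpha>)"
      using nz by (simp add: P_def powr_def)
    have "1 - (cmod z)\<^sup>2 = (1 - cmod z) * (1 + cmod z)"
      by (simp add: algebra_simps power2_eq_square)
    also have "\<dots> \<le> cmod (1 - z) * 2"
      using z1 norm_triangle_ineq2[of 1 z] by (intro mult_mono) auto
    finally have "(1 - (cmod z)\<^sup>2) powr \<alpha> \<le> (cmod (1 - z) * 2) powr \<alpha>"
      using z1 \<alpha> by (intro powr_mono2) (auto simp: abs_square_le_1)
    also have "\<dots> = 2 powr \<alpha> * cmod (1 - z) powr \<alpha>" by (simp add: powr_mult)
    finally have "(1 - (cmod z)\<^sup>2) powr \<alpha> * cmod (P z) \<le> 2 powr \<alpha> * cmod (1 - z) powr \<alpha> * cmod (P z)"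
      by (rule mult_right_mono) simp
    also have "\<dots> = 2 powr \<alpha>" using nz by (simp add: P powr_minus)
    finally have 1: "(1 - (cmod z)\<^sup>2) powr \<alpha> * cmod (P z) \<le> 2 powr \<alpha>" .
    have "cmod (F (W z)) \<le> exp ((Im (W z))\<^sup>2 / (2 * smooth_width\<^sup>2))"
      unfolding F_def using norm\<phi> by (intro norm_gauss_smooth_le[OF cont\<phi> _ \<sigma>]) auto
    also have "\<dots> \<le> exp ((pi / 2)\<^sup>2 / (2 * smooth_width\<^sup>2))"
      using power_mono[OF ImW[OF z], of 2] by (auto intro!: divide_right_mono)
    finally have 2: "cmod (F (W z)) \<le> exp ((pi / 2)\<^sup>2 / (2 * smooth_width\<^sup>2))" .
    from mult_mono[OF 1 2] show ?thesis by (simp add: f_def norm_mult test_bound_def mult.assoc)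
  qed
  moreover have "1/2 * (cmod (deriv h (of_real r)) / (1 - r\<^sup>2) powr \<alpha>) \<le> Re (f (of_real r) * deriv h (of_real r))"
    if r: "r \<in> {0..\<rho>}" for r
  proof -
    define w where "w = ln ((1 + r) / (1 - r))"
    have r1: "0 \<le> r" "r < 1" using r \<rho> by auto
    have "(1 + complex_of_real r) / (1 - of_real r) = of_real ((1 + r) / (1 - r))" by simp
    then have Ww: "W (of_real r) = of_real w"
      using r1 by (simp only: W_def w_def) (rule Ln_of_real, simp)
    have "w \<ge> 0" using r1 by (simp add: w_def)
    moreover have "w \<le> ln ((1 + \<rho>) / (1 - \<rho>))"
      unfolding w_def using r \<rho> by (intro ln_mono divide_pos_pos frac_le) auto
    ultimately have wT: "\<bar>w\<bar> \<le> T - 1" by (simp add: T_def)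
    have phase': "\<phi> w * deriv h (of_real r) = of_real (cmod (deriv h (of_real r)))"
      using phase[of w] tanh_half_ln[OF r1] by (simp add: w_def)
    have "cmod (F (of_real w) - \<phi> w) \<le> (pre_schwarzian_bound + 1) * smooth_width * sqrt (2 / pi)"
      unfolding F_def using norm\<phi> lip pre_schwarzian_bound_nonneg \<sigma> wT by (intro gauss_smooth_approx) auto
    also have "(pre_schwarzian_bound + 1) * smooth_width = 1/2"
      using pre_schwarzian_bound_nonneg by (simp add: smooth_width_def field_simps)
    also have "1/2 * sqrt (2 / pi) \<le> 1/2"
      using pi_gt3 by (simp add: real_sqrt_le_1_iff)
    finally have close: "cmod (F (of_real w) - \<phi> w) \<le> 1/2" .
    let ?d = "deriv h (of_real r)"
    have "\<bar>Re ((F (of_real w) - \<phi> w) * ?d)\<bar> \<le> 1/2 * cmod ?d"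
      using mult_right_mono[OF close, of "cmod ?d"]
      by (intro order_trans[OF abs_Re_le_cmod]) (simp only: norm_mult norm_ge_zero)
    moreover have "F (of_real w) * ?d = (F (of_real w) - \<phi> w) * ?d + of_real (cmod ?d)"
      using phase' by (simp add: algebra_simps)
    ultimately have ReF: "Re (F (of_real w) * ?d) \<ge> 1/2 * cmod ?d"
      by (simp only: plus_complex.sel Re_complex_of_real)
    have "P (of_real r) = of_real ((1 - r) powr (-\<alpha>))"
    proof -
      have "Ln (1 - of_real r) = of_real (ln (1 - r))"
        using Ln_of_real[of "1 - r"] r1 by simp
      then show ?thesis using r1 by (simp add: P_def powr_def flip: exp_of_real)
    qed
    then have Ref: "Re (f (of_real r) * ?d) = (1 - r) powr (-\<alpha>) * Re (F (of_real w) * ?d)"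
      by (simp add: f_def Ww mult.assoc)
    have "(1 - r\<^sup>2) powr (-\<alpha>) * (1/2 * cmod ?d) \<le> (1 - r) powr (-\<alpha>) * Re (F (of_real w) * ?d)"
    proof (rule mult_mono)
      show "(1 - r\<^sup>2) powr (-\<alpha>) \<le> (1 - r) powr (-\<alpha>)"
        using r1 \<alpha> by (intro powr_mono2') (auto simp: power2_eq_square mult_left_le)
    qed (rule ReF, simp_all)
    then show ?thesis
      unfolding Ref by (simp only: powr_minus divide_inverse mult_ac)
  qed
  ultimately show ?thesis using that by blast
qed

section \<open>The Volterra operator along radii\<close>

lemma volterra_primitive:
  assumes holf: "f holomorphic_on ball 0 1" and holg: "g holomorphic_on ball 0 1"
  obtains P where "\<And>z. z \<in> ball 0 1 \<Longrightarrow> (P has_field_derivative f z * deriv g z) (at z)"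
    and "\<And>z. z \<in> ball 0 1 \<Longrightarrow> volterra g f z = P z - P 0"
proof -
  have hol: "(\<lambda>z. f z * deriv g z) holomorphic_on ball 0 1"
    using holg by (intro holomorphic_intros holf holomorphic_deriv) auto
  obtain P where P: "\<And>z. z \<in> ball 0 1 \<Longrightarrow> (P has_field_derivative f z * deriv g z) (at z within ball 0 1)"
    by (rule holomorphic_convex_primitive'[OF convex_ball open_ball hol]) (rule that)
  have "volterra g f z = P z - P 0" if z: "z \<in> ball 0 1" for z
  proof -
    have "closed_segment 0 z \<subseteq> ball 0 1" using z by (intro closed_segment_subset) auto
    then have "((\<lambda>z. f z * deriv g z) has_contour_integral (P z - P 0)) (linepath 0 z)"
      using contour_integral_primitive[OF P, of "linepath 0 z"] by simp
    then show ?thesis unfolding volterra_def by (rule contour_integral_unique)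
  qed
  moreover have "(P has_field_derivative f z * deriv g z) (at z)" if "z \<in> ball 0 1" for z
    using P[OF that] at_within_open[OF that open_ball] by simp
  ultimately show ?thesis using that by blast
qed

lemma volterra_holomorphic:
  assumes "f holomorphic_on ball 0 1" and "g holomorphic_on ball 0 1"
  shows "volterra g f holomorphic_on ball 0 1"
proof -
  obtain P where P: "\<And>z. z \<in> ball 0 1 \<Longrightarrow> (P has_field_derivative f z * deriv g z) (at z)"
    and V: "\<And>z. z \<in> ball 0 1 \<Longrightarrow> volterra g f z = P z - P 0"
    using volterra_primitive[OF assms] by metis
  have "(\<lambda>z. P z - P 0) holomorphic_on ball 0 1"
    using P by (intro holomorphic_intros) (meson holomorphic_on_open open_ball)
  then show ?thesis by (rule holomorphic_transform) (simp add: V)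
qed

lemma volterra_radial_has_integral:
  assumes "f holomorphic_on ball 0 1" and "g holomorphic_on ball 0 1"
    and c: "cmod c = 1" and \<rho>: "0 \<le> \<rho>" "\<rho> < 1"
  shows "((\<lambda>r. f (of_real r * c) * deriv g (of_real r * c) * c) has_integral
           volterra g f (of_real \<rho> * c)) {0..\<rho>}"
proof -
  obtain P where P: "\<And>z. z \<in> ball 0 1 \<Longrightarrow> (P has_field_derivative f z * deriv g z) (at z)"
    and V: "\<And>z. z \<in> ball 0 1 \<Longrightarrow> volterra g f z = P z - P 0"
    using volterra_primitive[OF assms(1,2)] by metis
  have "((\<lambda>r. f (of_real r * c) * deriv g (of_real r * c) * c) has_integral
           P (of_real \<rho> * c) - P (of_real 0 * c)) {0..\<rho>}"
  proof (rule fundamental_theorem_of_calculus[OF \<rho>(1)])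
    fix r assume "r \<in> {0..\<rho>}"
    then have "of_real r * c \<in> ball 0 1" using c \<rho> by (simp add: norm_mult)
    moreover have "((\<lambda>r. complex_of_real r * c) has_vector_derivative c) (at r within {0..\<rho>})"
      by (auto intro!: derivative_eq_intros)
    ultimately show "((\<lambda>r. P (of_real r * c)) has_vector_derivative
        f (of_real r * c) * deriv g (of_real r * c) * c) (at r within {0..\<rho>})"
      using field_vector_diff_chain_within[OF _ has_field_derivative_at_within[OF P], of "\<lambda>r. of_real r * c" c r "{0..\<rho>}"]
      by (simp add: o_def mult.commute mult.left_commute)
  qed
  then show ?thesis using V[of "of_real \<rho> * c"] c \<rho> by (simp add: norm_mult)
qed

lemma volterra_add:
  assumes "f holomorphic_on ball 0 1" "h holomorphic_on ball 0 1" "g holomorphic_on ball 0 1"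
    and z: "z \<in> ball 0 1"
  shows "volterra g (\<lambda>w. f w + h w) z = volterra g f z + volterra g h z"
proof -
  have seg: "closed_segment 0 z \<subseteq> ball 0 1" using z by (intro closed_segment_subset) auto
  have "(\<lambda>w. u w * deriv g w) contour_integrable_on linepath 0 z" if "u holomorphic_on ball 0 1" for u
  proof (rule contour_integrable_continuous_linepath)
    have "(\<lambda>w. u w * deriv g w) holomorphic_on ball 0 1"
      using assms(3) by (intro holomorphic_intros that holomorphic_deriv) auto
    then show "continuous_on (closed_segment 0 z) (\<lambda>w. u w * deriv g w)"
      using seg holomorphic_on_imp_continuous_on continuous_on_subset by blast
  qed
  then show ?thesis
    using assms by (simp add: volterra_def distrib_right contour_integral_add)
qed

lemma volterra_cmult:
  assumes "f holomorphic_on ball 0 1" "g holomorphic_on ball 0 1"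
    and z: "z \<in> ball 0 1"
  shows "volterra g (\<lambda>w. c * f w) z = c * volterra g f z"
proof -
  obtain P where P: "\<And>z. z \<in> ball 0 1 \<Longrightarrow> (P has_field_derivative f z * deriv g z) (at z)"
    and V: "\<And>z. z \<in> ball 0 1 \<Longrightarrow> volterra g f z = P z - P 0"
    using volterra_primitive[OF assms(1,2)] by metis
  have seg: "closed_segment 0 z \<subseteq> ball 0 1" using z by (intro closed_segment_subset) auto
  have "((\<lambda>z. c * f z * deriv g z) has_contour_integral (c * P z - c * P 0)) (linepath 0 z)"
    using contour_integral_primitive[of "ball 0 1" "\<lambda>z. c * P z" "\<lambda>z. c * f z * deriv g z" "linepath 0 z"] seg
      DERIV_cmult[OF P, THEN has_field_derivative_at_within]
    by (simp add: mult.assoc)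
  then show ?thesis using V[OF z]
    by (simp add: volterra_def contour_integral_unique right_diff_distrib)
qed

text \<open>
The integral over the half-open interval is the supremum of those over \<open>[0, \<rho>]\<close>. This form links the
Lebesgue integral of a continuous function on \<open>[0, 1)\<close>, which may be infinite, with the
gauge integrals that arise from contour integrals.
\<close>

lemma nn_integral_half_open_unit:
  fixes w :: "real \<Rightarrow> real"
  assumes cont: "continuous_on {0..<1} w" and nonneg: "\<And>r. r \<in> {0..<1} \<Longrightarrow> 0 \<le> w r"
  shows "\<rho> < 1 \<Longrightarrow> ennreal (integral {0..\<rho>} w) \<le> (\<integral>\<^sup>+ r\<in>{0..<1}. ennreal (w r) \<partial>lborel)"
    and "(\<And>\<rho>. 0 \<le> \<rho> \<Longrightarrow> \<rho> < 1 \<Longrightarrow> integral {0..\<rho>} w \<le> K) \<Longrightarrow> (\<integral>\<^sup>+ r\<in>{0..<1}. ennreal (w r) \<partial>lborel) \<le> ennreal K"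
proof -
  have cont': "continuous_on {0..\<rho>} w" if "\<rho> < 1" for \<rho>
    using cont by (rule continuous_on_subset) (use that in auto)
  have eq: "(\<integral>\<^sup>+ r\<in>{0..\<rho>}. ennreal (w r) \<partial>lborel) = ennreal (integral {0..\<rho>} w)" if "\<rho> < 1" for \<rho>
    using that nonneg by (intro nn_integral_has_integral_lebesgue' integrable_integral
        integrable_continuous_real cont') auto
  show "ennreal (integral {0..\<rho>} w) \<le> (\<integral>\<^sup>+ r\<in>{0..<1}. ennreal (w r) \<partial>lborel)" if "\<rho> < 1"
    unfolding eq[OF that, symmetric] using that by (intro nn_integral_mono) (auto simp: indicator_def)
  assume K: "\<And>\<rho>. 0 \<le> \<rho> \<Longrightarrow> \<rho> < 1 \<Longrightarrow> integral {0..\<rho>} w \<le> K"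
  define b where "b = (\<lambda>n::nat. 1 - 1 / (real n + 1))"
  define F where "F = (\<lambda>n r. ennreal (w r) * indicator {0..b n} r)"
  have b: "0 \<le> b n" "b n < 1" for n by (auto simp: b_def field_simps)
  have b_mono: "b m \<le> b n" if "m \<le> n" for m n
    using that by (auto simp: b_def intro!: divide_left_mono)
  have inc: "incseq F"
  proof (intro incseq_SucI le_funI)
    show "F n r \<le> F (Suc n) r" for n r
      using b_mono[of n "Suc n"] by (auto simp: F_def indicator_def)
  qed
  have "(SUP n. F n r) = ennreal (w r) * indicator {0..<1} r" for r
  proof (cases "r \<in> {0..<1}")
    case True
    have "b \<longlonglongrightarrow> 1"
      unfolding b_def by real_asymp
    then have "\<forall>\<^sub>F n in sequentially. r < b n"
      using True by (auto intro: order_tendstoD)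
    then obtain n where n: "r < b n" by (auto simp: eventually_sequentially)
    have "(SUP n. F n r) = ennreal (w r)"
    proof (rule antisym)
      show "(SUP n. F n r) \<le> ennreal (w r)" by (rule SUP_least) (simp add: F_def indicator_def)
      have "ennreal (w r) = F n r" using True n by (simp add: F_def)
      also have "\<dots> \<le> (SUP n. F n r)" by (rule SUP_upper) simp
      finally show "ennreal (w r) \<le> (SUP n. F n r)" .
    qed
    then show ?thesis using True by simp
  next
    case False
    then have "F n r = 0" for n using b(2)[of n] by (auto simp: F_def indicator_def)
    then show ?thesis using False by simp
  qed
  then have "(\<integral>\<^sup>+ r\<in>{0..<1}. ennreal (w r) \<partial>lborel) = (\<integral>\<^sup>+ r. (SUP n. F n r) \<partial>lborel)" by simp
  also have "\<dots> = (SUP n. integral\<^sup>N lborel (F n))"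
  proof (rule nn_integral_monotone_convergence_SUP[OF inc])
    fix n
    have "(\<lambda>r. indicator {0..b n} r *\<^sub>R w r) \<in> borel_measurable borel"
      by (rule borel_measurable_continuous_on_indicator[OF _ cont'[OF b(2)]]) simp
    then have "(\<lambda>r. ennreal (indicator {0..b n} r *\<^sub>R w r)) \<in> borel_measurable lborel" by simp
    also have "(\<lambda>r. ennreal (indicator {0..b n} r *\<^sub>R w r)) = F n"
      by (auto simp: F_def indicator_def)
    finally show "F n \<in> borel_measurable lborel" .
  qed
  also have "\<dots> \<le> ennreal K"
  proof (rule SUP_least)
    fix n
    have "integral\<^sup>N lborel (F n) = ennreal (integral {0..b n} w)"
      unfolding F_def by (rule eq[OF b(2)])
    also have "\<dots> \<le> ennreal K" by (intro ennreal_leI K b)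
    finally show "integral\<^sup>N lborel (F n) \<le> ennreal K" .
  qed
  finally show "(\<integral>\<^sup>+ r\<in>{0..<1}. ennreal (w r) \<partial>lborel) \<le> ennreal K" .
qed

definition radial_density :: "(complex \<Rightarrow> complex) \<Rightarrow> real \<Rightarrow> complex \<Rightarrow> real \<Rightarrow> real" where
  "radial_density g \<alpha> c r = cmod (deriv g (of_real r * c)) / (1 - r\<^sup>2) powr \<alpha>"

lemma radial_density_nonneg: "radial_density g \<alpha> c r \<ge> 0"
  by (simp add: radial_density_def)

lemma radial_density_continuous:
  assumes holg: "g holomorphic_on ball 0 1" and c: "cmod c = 1"
  shows "continuous_on {0..<1} (radial_density g \<alpha> c)"
proof -
  have pos: "1 - r\<^sup>2 > 0" if "r \<in> {0..<1}" for r :: real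
    using that by (simp add: abs_square_less_1)
  have "deriv g holomorphic_on ball 0 1" using holg by (intro holomorphic_deriv) auto
  then have "continuous_on (ball 0 1) (deriv g)" by (rule holomorphic_on_imp_continuous_on)
  then have "continuous_on {0..<1} (\<lambda>r. deriv g (of_real r * c))"
    by (rule continuous_on_compose2) (use c in \<open>auto intro!: continuous_intros simp: norm_mult\<close>)
  then show ?thesis
    unfolding radial_density_def[abs_def]
    using pos by (intro continuous_intros) fastforce+
qed

lemma Hv_le_norm:
  assumes "f \<in> Hv \<alpha>" "z \<in> ball 0 1"
  shows "(1 - (cmod z)\<^sup>2) powr \<alpha> * cmod (f z) \<le> Hv_norm \<alpha> f"
  using assms unfolding Hv_norm_def v_weight_def Hv_def by (auto intro!: cSUP_upper)

text \<open>
Integrate along the radius through \<open>z\<close> and estimate \<open>f\<close> there by its weighted norm.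
\<close>

lemma volterra_norm_le:
  assumes holg: "g holomorphic_on ball 0 1" and f: "f \<in> Hv \<alpha>" and z: "z \<in> ball 0 1"
    and M: "\<And>\<theta>. \<theta> \<in> {0..<2 * pi} \<Longrightarrow>
      (\<integral>\<^sup>+ r\<in>{0..<1}. ennreal (radial_density g \<alpha> (cis \<theta>) r) \<partial>lborel) \<le> ennreal M" and "M \<ge> 0"
  shows "cmod (volterra g f z) \<le> M * Hv_norm \<alpha> f"
proof -
  have holf: "f holomorphic_on ball 0 1" using f by (simp add: Hv_def)
  define \<theta> where "\<theta> = Arg2pi z"
  have \<theta>: "\<theta> \<in> {0..<2 * pi}" using Arg2pi[of z] by (simp add: \<theta>_def)
  define \<rho> where "\<rho> = cmod z"
  have \<rho>: "0 \<le> \<rho>" "\<rho> < 1" using z by (auto simp: \<rho>_def)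
  have zeq: "z = of_real \<rho> * cis \<theta>"
    using Arg2pi_eq[of z] by (simp add: \<rho>_def \<theta>_def cis_conv_exp)
  let ?w = "radial_density g \<alpha> (cis \<theta>)"
  have cont: "continuous_on {0..<1} ?w" by (rule radial_density_continuous[OF holg]) simp
  have intw: "?w integrable_on {0..\<rho>}"
    by (rule integrable_continuous_real, rule continuous_on_subset[OF cont]) (use \<rho> in auto)
  have N0: "0 \<le> Hv_norm \<alpha> f"
    by (rule order_trans[OF _ Hv_le_norm[OF f, of 0]]) auto
  have "ennreal (integral {0..\<rho>} ?w) \<le> ennreal M"
    using nn_integral_half_open_unit(1)[OF cont radial_density_nonneg \<rho>(2)] M[OF \<theta>] by (rule order_trans)
  then have le: "integral {0..\<rho>} ?w \<le> M" using \<open>M \<ge> 0\<close> by simp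
  have int: "((\<lambda>r. f (of_real r * cis \<theta>) * deriv g (of_real r * cis \<theta>) * cis \<theta>) has_integral
           volterra g f z) {0..\<rho>}"
    unfolding zeq by (rule volterra_radial_has_integral[OF holf holg _ \<rho>]) simp
  have "cmod (volterra g f z) \<le> integral {0..\<rho>} (\<lambda>r. Hv_norm \<alpha> f * ?w r)"
    unfolding integral_unique[OF int, symmetric]
  proof (rule integral_norm_bound_integral)
    show "(\<lambda>r. Hv_norm \<alpha> f * ?w r) integrable_on {0..\<rho>}"
      using intw by (rule integrable_on_mult_right)
    fix r assume r: "r \<in> {0..\<rho>}"
    have in_ball: "of_real r * cis \<theta> \<in> ball 0 1" using r \<rho> by (simp add: norm_mult)
    have pos: "(1 - r\<^sup>2) powr \<alpha> > 0" using r \<rho> by (simp add: power2_eq_1_iff abs_square_eq_1)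
    have "(1 - r\<^sup>2) powr \<alpha> * cmod (f (of_real r * cis \<theta>)) \<le> Hv_norm \<alpha> f"
      using Hv_le_norm[OF f in_ball] r by (simp add: norm_mult)
    then have "cmod (f (of_real r * cis \<theta>)) \<le> Hv_norm \<alpha> f / (1 - r\<^sup>2) powr \<alpha>"
      using pos by (simp add: field_simps)
    from mult_right_mono[OF this, of "cmod (deriv g (of_real r * cis \<theta>))"]
    show "cmod (f (of_real r * cis \<theta>) * deriv g (of_real r * cis \<theta>) * cis \<theta>) \<le> Hv_norm \<alpha> f * ?w r"
      by (simp add: norm_mult radial_density_def)
  qed (use int in auto)
  also have "\<dots> = Hv_norm \<alpha> f * integral {0..\<rho>} ?w" by simp
  also have "\<dots> \<le> Hv_norm \<alpha> f * M" using le N0 by (rule mult_left_mono)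
  finally show ?thesis by (simp add: mult.commute)
qed

text \<open>
The test function for the radius in direction \<open>c\<close> is the one for \<open>h z = g (c z)\<close>, rotated back. The
derivative \<open>h'\<close> contains the factor \<open>c\<close> that also comes from parametrizing the radius, so the
integrand of \<open>T_g f\<close> along the radius is exactly the product whose real part was bounded below.
\<close>

lemma radial_integral_le_volterra:
  assumes holg: "g holomorphic_on ball 0 1" and inj: "inj_on g (ball 0 1)" and \<alpha>: "\<alpha> \<ge> 0"
    and c: "cmod c = 1" and \<rho>: "0 \<le> \<rho>" "\<rho> < 1"
  obtains f where "f \<in> Hv \<alpha>" and "Hv_norm \<alpha> f \<le> test_bound \<alpha>"
    and "integral {0..\<rho>} (radial_density g \<alpha> c) \<le> 2 * cmod (volterra g f (of_real \<rho> * c))"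
proof -
  define h where "h = (\<lambda>z. g (z * c))"
  have c0: "c \<noteq> 0" using c by auto
  have rot: "z * c \<in> ball 0 1" if "z \<in> ball 0 1" for z using that c by (simp add: norm_mult)
  have dh: "(h has_field_derivative deriv g (z * c) * c) (at z)" if z: "z \<in> ball 0 1" for z
    unfolding h_def
    by (rule DERIV_chain2[where f = g and g = "\<lambda>z. z * c", OF holomorphic_derivI[OF holg open_ball rot[OF z]]])
       (auto intro!: derivative_eq_intros)
  have holh: "h holomorphic_on ball 0 1" using dh by (metis holomorphic_on_open open_ball)
  have injh: "inj_on h (ball 0 1)"
  proof (rule inj_onI)
    fix x y assume "x \<in> ball 0 1" "y \<in> ball 0 1" "h x = h y"
    then have "x * c = y * c" using inj rot by (auto simp: h_def dest: inj_onD)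
    then show "x = y" using c0 by simp
  qed
  obtain f0 where holf0: "f0 holomorphic_on ball 0 1"
    and f0_le: "\<And>z. z \<in> ball 0 1 \<Longrightarrow> (1 - (cmod z)\<^sup>2) powr \<alpha> * cmod (f0 z) \<le> test_bound \<alpha>"
    and f0_ge: "\<And>r. r \<in> {0..\<rho>} \<Longrightarrow>
      1/2 * (cmod (deriv h (of_real r)) / (1 - r\<^sup>2) powr \<alpha>) \<le> Re (f0 (of_real r) * deriv h (of_real r))"
    using radial_test_function[OF holh injh \<alpha> \<rho>] by metis
  define f where "f = (\<lambda>z. f0 (z / c))"
  have rot': "z / c \<in> ball 0 1" if "z \<in> ball 0 1" for z using that c by (simp add: norm_divide)
  have "f0 \<circ> (\<lambda>z. z / c) holomorphic_on ball 0 1"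
    by (rule holomorphic_on_compose_gen[OF _ holf0]) (use rot' c0 in \<open>auto intro!: holomorphic_intros\<close>)
  then have holf: "f holomorphic_on ball 0 1" by (simp add: f_def o_def)
  have f_le: "v_weight \<alpha> z * cmod (f z) \<le> test_bound \<alpha>" if "z \<in> ball 0 1" for z
    using f0_le[OF rot'[OF that]] c by (simp add: f_def v_weight_def norm_divide)
  have fHv: "f \<in> Hv \<alpha>" unfolding Hv_def bdd_above_def using holf f_le by blast
  have norm_le: "Hv_norm \<alpha> f \<le> test_bound \<alpha>"
    unfolding Hv_norm_def by (rule cSUP_least) (use f_le in auto)
  let ?V = "volterra g f (of_real \<rho> * c)"
  let ?w = "radial_density g \<alpha> c"
  have int: "((\<lambda>r. f (of_real r * c) * deriv g (of_real r * c) * c) has_integral ?V) {0..\<rho>}"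
    by (rule volterra_radial_has_integral[OF holf holg c \<rho>])
  have "(?w has_integral integral {0..\<rho>} ?w) {0..\<rho>}"
    by (intro integrable_integral integrable_continuous_real
          continuous_on_subset[OF radial_density_continuous[OF holg c]]) (use \<rho> in auto)
  then have "((\<lambda>r. 1/2 * ?w r) has_integral 1/2 * integral {0..\<rho>} ?w) {0..\<rho>}"
    by (rule has_integral_mult_right)
  moreover have "((\<lambda>r. Re (f (of_real r * c) * deriv g (of_real r * c) * c)) has_integral Re ?V) {0..\<rho>}"
    using has_integral_linear[OF int bounded_linear_Re] by (simp add: o_def)
  ultimately have "1/2 * integral {0..\<rho>} ?w \<le> Re ?V"
  proof (rule has_integral_le)
    fix r assume r: "r \<in> {0..\<rho>}"
    then have "deriv h (of_real r) = deriv g (of_real r * c) * c"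
      using \<rho> by (intro DERIV_imp_deriv dh) auto
    then show "1/2 * ?w r \<le> Re (f (of_real r * c) * deriv g (of_real r * c) * c)"
      using f0_ge[OF r] c c0 by (simp add: radial_density_def f_def norm_mult mult.assoc)
  qed
  also have "\<dots> \<le> cmod ?V" by (rule complex_Re_le_cmod)
  finally show ?thesis using that fHv norm_le by simp
qed

section \<open>Boundedness and radial integrals\<close>

theorem theorem2p2:
  fixes g :: "complex \<Rightarrow> complex" and \<alpha> :: real
  assumes "g holomorphic_on unit_disc"
    and "inj_on g unit_disc"
    and "0 \<le> \<alpha>" and "\<alpha> < 1"
  shows "bounded_linear_operator (Hv \<alpha>) (Hv_norm \<alpha>) Hinf Hinf_norm (volterra g) \<longleftrightarrow>
    (SUP \<theta>\<in>{0..<2 * pi}. \<integral>\<^sup>+ r\<in>{0..<1}.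
        ennreal (cmod (deriv g (of_real r * cis \<theta>)) / (1 - r\<^sup>2) powr \<alpha>) \<partial>lborel) < \<infinity>"
  (is "?bounded \<longleftrightarrow> (SUP \<theta>\<in>_. ?I \<theta>) < \<infinity>")
proof
  have I: "?I \<theta> = (\<integral>\<^sup>+ r\<in>{0..<1}. ennreal (radial_density g \<alpha> (cis \<theta>) r) \<partial>lborel)" for \<theta>
    by (simp add: radial_density_def)
  {
    assume ?bounded
    then have maps: "volterra g f \<in> Hinf" if "f \<in> Hv \<alpha>" for f
      using that by (simp add: bounded_linear_operator_def)
    from \<open>?bounded\<close> obtain C
      where C: "\<And>f. f \<in> Hv \<alpha> \<Longrightarrow> Hinf_norm (volterra g f) \<le> C * Hv_norm \<alpha> f"
      unfolding bounded_linear_operator_def by blast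
    define K where "K = 2 * (\<bar>C\<bar> * test_bound \<alpha>)"
    have "?I \<theta> \<le> ennreal K" for \<theta>
      unfolding I
    proof (rule nn_integral_half_open_unit(2))
      show "continuous_on {0..<1} (radial_density g \<alpha> (cis \<theta>))"
        by (rule radial_density_continuous[OF assms(1)]) simp
      show "integral {0..\<rho>} (radial_density g \<alpha> (cis \<theta>)) \<le> K" if \<rho>: "0 \<le> \<rho>" "\<rho> < 1" for \<rho>
      proof -
        obtain f where f: "f \<in> Hv \<alpha>" "Hv_norm \<alpha> f \<le> test_bound \<alpha>"
          and le: "integral {0..\<rho>} (radial_density g \<alpha> (cis \<theta>)) \<le> 2 * cmod (volterra g f (of_real \<rho> * cis \<theta>))"
          using radial_integral_le_volterra[OF assms(1-3) _ \<rho>, of "cis \<theta>"] by auto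
        have "0 \<le> Hv_norm \<alpha> f"
          by (rule order_trans[OF _ Hv_le_norm[OF f(1), of 0]]) auto
        then have "C * Hv_norm \<alpha> f \<le> \<bar>C\<bar> * test_bound \<alpha>"
          using f(2) by (intro mult_mono) auto
        moreover have "cmod (volterra g f (of_real \<rho> * cis \<theta>)) \<le> Hinf_norm (volterra g f)"
          unfolding Hinf_norm_def
        proof (rule cSUP_upper)
          show "of_real \<rho> * cis \<theta> \<in> unit_disc" using \<rho> by (simp add: norm_mult)
          show "bdd_above ((\<lambda>z. cmod (volterra g f z)) ` unit_disc)"
            using maps[OF f(1)] by (auto simp: Hinf_def bounded_iff bdd_above_def)
        qed
        ultimately show ?thesis using le C[OF f(1)] by (simp add: K_def)
      qed
    qed (simp add: radial_density_nonneg)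
    then have "(SUP \<theta>\<in>{0..<2 * pi}. ?I \<theta>) \<le> ennreal K" by (rule SUP_least)
    also have "ennreal K < \<infinity>" by simp
    finally show "(SUP \<theta>\<in>{0..<2 * pi}. ?I \<theta>) < \<infinity>" .
  }
  {
    assume fin: "(SUP \<theta>\<in>{0..<2 * pi}. ?I \<theta>) < \<infinity>"
    define M where "M = enn2real (SUP \<theta>\<in>{0..<2 * pi}. ?I \<theta>)"
    have M: "?I \<theta> \<le> ennreal M" if "\<theta> \<in> {0..<2 * pi}" for \<theta>
    proof -
      have "?I \<theta> \<le> (SUP \<theta>\<in>{0..<2 * pi}. ?I \<theta>)" using that by (rule SUP_upper)
      also have "\<dots> = ennreal M" using fin by (simp add: M_def)
      finally show ?thesis .
    qed
    have bound: "cmod (volterra g f z) \<le> M * Hv_norm \<alpha> f" if "f \<in> Hv \<alpha>" "z \<in> unit_disc" for f z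
      using volterra_norm_le[OF assms(1) that M[unfolded I]] by (simp add: M_def)
    have hol: "f holomorphic_on unit_disc" if "f \<in> Hv \<alpha>" for f
      using that by (simp add: Hv_def)
    show ?bounded
      unfolding bounded_linear_operator_def
    proof (intro conjI ballI allI)
      show "volterra g f \<in> Hinf" if "f \<in> Hv \<alpha>" for f
        using volterra_holomorphic[OF hol[OF that] assms(1)] bound[OF that]
        unfolding Hinf_def bounded_iff by blast
      show "volterra g (\<lambda>w. f w + h w) z = volterra g f z + volterra g h z"
        if "f \<in> Hv \<alpha>" "h \<in> Hv \<alpha>" "z \<in> unit_disc" for f h z
        by (rule volterra_add[OF hol hol assms(1)]) (use that in auto)
      show "volterra g (\<lambda>w. c * f w) z = c * volterra g f z" if "f \<in> Hv \<alpha>" "z \<in> unit_disc" for c f z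
        by (rule volterra_cmult[OF hol assms(1)]) (use that in auto)
      have "Hinf_norm (volterra g f) \<le> M * Hv_norm \<alpha> f" if "f \<in> Hv \<alpha>" for f
        unfolding Hinf_norm_def by (rule cSUP_least) (use bound[OF that] in auto)
      then show "\<exists>C. \<forall>f\<in>Hv \<alpha>. Hinf_norm (volterra g f) \<le> C * Hv_norm \<alpha> f" by blast
    qed
  }
qed

end
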